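(* Let $p, q \in \mathbb{N}$ with $p < q$. For each $n \in \mathbb{N}$, define $a_n := |M_{p,q,n+q}|$. Then for every $n \in \mathbb{N}$, $$a_{n+q+1} \ =\ a_{n+q} + a_n + (q-p)\,|M_{q,n}|.$$
   Context: $\mathbb{N} = \{1,2,3,\dots\}$. For a finite nonempty set $S \subseteq \mathbb{N}$, $|S|$ denotes its cardinality and $\min_2 S$ denotes its second smallest element if $|S| \ge 2$; if $|S| = 1$, then $\min_2 S$ is by convention the unique element of $S$ (so $\min_2 S = \min S$). For $p, q, n \in \mathbb{N}$, define $$M_{q,n} := \{S \subseteq \mathbb{N} : S \text{ is finite and nonempty},\ \max S = n,\ \min S \ge q|S|\},$$ $$M_{p,q,n} := \{S \subseteq \mathbb{N} : S \text{ is finite and nonempty},\ \max S = n,\ \min S \ge p|S|,\ \textstyle\min_2 S \ge q|S|\}.$$ *)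

theory Defs
  imports Main
begin

(* The positive integers are modelled inside nat, hence the explicit
   restriction S \<subseteq> {1..} below. *)

definition min2 :: "nat set \<Rightarrow> nat" where
  "min2 S = (if card S \<ge> 2 then Min (S - {Min S}) else Min S)"

definition Mq :: "nat \<Rightarrow> nat \<Rightarrow> nat set set" where
  "Mq q n = {S. S \<subseteq> {1..} \<and> finite S \<and> S \<noteq> {} \<and> Max S = n \<and> Min S \<ge> q * card S}"

definition Mpq :: "nat \<Rightarrow> nat \<Rightarrow> nat \<Rightarrow> nat set set" where
  "Mpq p q n = {S. S \<subseteq> {1..} \<and> finite S \<and> S \<noteq> {} \<and> Max S = n \<and>
     Min S \<ge> p * card S \<and> min2 S \<ge> q * card S}"

(* Both families are finite, so that card is their true cardinality. *)

lemma finite_Mq: "finite (Mq q n)"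
  by (rule finite_subset[of _ "Pow {..n}"]) (auto simp: Mq_def)

lemma finite_Mpq: "finite (Mpq p q n)"
  by (rule finite_subset[of _ "Pow {..n}"]) (auto simp: Mpq_def)

end

theory Submission
  imports Defs
begin

text \<open>
  Put \<open>m = n + 2 * q\<close>.  The sets \<open>S\<close> in \<open>Mpq p q (m + 1)\<close> fall into three classes, one for each
  summand of the recurrence.

  If \<open>m \<notin> S\<close>, lowering the maximum from \<open>m + 1\<close> to \<open>m\<close> keeps the cardinality and is reversible, so
  this class has as many members as \<open>Mpq p q m\<close>
  (lemma \<open>card_Mpq_Suc_without_predecessor\<close>).

  If \<open>m \<in> S\<close>, delete \<open>m + 1\<close>.  The cardinality drops by one, so the bound on the second smallest
  element drops by \<open>q\<close> and the bound on the minimum only by \<open>p\<close>.  Shifting everything down by \<open>q\<close>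
  therefore lands in \<open>Mpq p q (m - q)\<close> exactly when the minimum exceeds its bound \<open>p * card S\<close> by
  at least \<open>q - p\<close>, and all of \<open>Mpq p q (m - q)\<close> arises in this way
  (lemma \<open>card_Mpq_Suc_large_Min\<close>).

  There remain the sets with \<open>m \<in> S\<close> whose minimum is \<open>p * card S + j\<close> with \<open>j < q - p\<close>.
  Such a minimum is below \<open>q * card S\<close>, hence
  below every number that the bound allows as second smallest element.  So \<open>j\<close> can be chosen
  independently of the rest of the set.  Deleting the minimum and \<open>m + 1\<close> lowers the cardinality
  by two, and a shift by \<open>2 * q\<close> turns what is left into an arbitrary member of \<open>Mq q n\<close>
  (lemma \<open>card_Mpq_Suc_small_Min\<close>).  This gives \<open>(q - p) * card (Mq q n)\<close>.
\<close>

section \<open>Membership in the two families\<close>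

lemma mem_Mq_iff:
  assumes "q \<ge> 1"
  shows "S \<in> Mq q n \<longleftrightarrow> finite S \<and> n \<in> S \<and> (\<forall>x\<in>S. q * card S \<le> x \<and> x \<le> n)"
proof
  assume "S \<in> Mq q n"
  then have fin: "finite S" and ne: "S \<noteq> {}" and mx: "Max S = n" and mn: "q * card S \<le> Min S"
    by (auto simp: Mq_def)
  have "n \<in> S" using Max_in[OF fin ne] mx by simp
  moreover have "q * card S \<le> x \<and> x \<le> n" if "x \<in> S" for x
    using Min_le[OF fin that] Max_ge[OF fin that] mx mn by linarith
  ultimately show "finite S \<and> n \<in> S \<and> (\<forall>x\<in>S. q * card S \<le> x \<and> x \<le> n)"
    using fin by blast
next
  assume R: "finite S \<and> n \<in> S \<and> (\<forall>x\<in>S. q * card S \<le> x \<and> x \<le> n)"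
  then have ne: "S \<noteq> {}" and fin: "finite S" by auto
  then have "q * card S \<ge> 1" using assms by (simp add: Suc_le_eq card_gt_0_iff)
  then have "S \<subseteq> {1..}" using R by (meson atLeast_iff le_trans subsetI)
  moreover have "Max S = n" using R by (intro Max_eqI) auto
  moreover have "q * card S \<le> Min S" using R Min_in[OF fin ne] by blast
  ultimately show "S \<in> Mq q n"
    using fin ne unfolding Mq_def by blast
qed

text \<open>
  The second smallest element disappears from the description: it is at least \<open>c\<close> iff every
  element with a smaller one below it is at least \<open>c\<close>.  The condition \<open>q * card S \<le> n\<close> is listed
  separately because of the singletons, where \<open>min2\<close> is the only element; for larger \<open>S\<close> it
  follows, as \<open>n\<close> is not the minimum.  Positivity of \<open>p\<close> makes \<open>S \<subseteq> {1..}\<close> automatic.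
\<close>

lemma mem_Mpq_iff:
  assumes "p \<ge> 1"
  shows "S \<in> Mpq p q n \<longleftrightarrow> finite S \<and> n \<in> S \<and> q * card S \<le> n
    \<and> (\<forall>x\<in>S. p * card S \<le> x \<and> x \<le> n)
    \<and> (\<forall>x\<in>S. \<forall>y\<in>S. y < x \<longrightarrow> q * card S \<le> x)"
    (is "_ \<longleftrightarrow> ?R")
proof
  assume "S \<in> Mpq p q n"
  then have fin: "finite S" and ne: "S \<noteq> {}" and mx: "Max S = n"
    and mn: "p * card S \<le> Min S" and mn2: "q * card S \<le> min2 S"
    by (auto simp: Mpq_def)
  have n: "n \<in> S" using Max_in[OF fin ne] mx by simp
  have bounds: "p * card S \<le> x \<and> x \<le> n" if "x \<in> S" for x
    using Min_le[OF fin that] Max_ge[OF fin that] mx mn by linarith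
  have snd: "q * card S \<le> x" if x: "x \<in> S" and y: "y \<in> S" and less: "y < x" for x y
  proof -
    have "card {y, x} \<le> card S" using x y fin by (intro card_mono) auto
    then have "min2 S = Min (S - {Min S})" using less by (simp add: min2_def)
    moreover have "x \<in> S - {Min S}" using x less Min_le[OF fin y] by auto
    then have "Min (S - {Min S}) \<le> x" using fin by (intro Min_le) auto
    ultimately show ?thesis using mn2 by linarith
  qed
  have "q * card S \<le> n"
  proof (cases "\<exists>y\<in>S. y < n")
    case True
    then show ?thesis using snd n by blast
  next
    case False
    then have "S = {n}" using n bounds by force
    then show ?thesis using mn2 by (simp add: min2_def)
  qed
  then show ?R using fin n bounds snd by blast
next
  assume R: ?R
  then have ne: "S \<noteq> {}" and fin: "finite S" by auto
  then have pos: "p * card S \<ge> 1" using assms by (simp add: Suc_le_eq card_gt_0_iff)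
  have mx: "Max S = n" using R by (intro Max_eqI) auto
  have mn: "Min S \<in> S" using fin ne by (rule Min_in)
  have "q * card S \<le> min2 S"
  proof (cases "card S \<ge> 2")
    case True
    then have "S - {Min S} \<noteq> {}"
      using mn fin card_Diff_singleton[OF mn] by (metis card.empty diff_is_0_eq not_less_eq_eq numeral_2_eq_2 One_nat_def)
    then have in2: "Min (S - {Min S}) \<in> S - {Min S}" using fin by (intro Min_in) auto
    moreover have "Min S < Min (S - {Min S})"
      using in2 Min_le[OF fin, of "Min (S - {Min S})"] by auto
    ultimately show ?thesis using R mn True by (auto simp: min2_def)
  next
    case False
    then have "card S = 1" using fin ne by (metis One_nat_def Suc_leI card_gt_0_iff le_antisym not_less_eq_eq numeral_2_eq_2)
    then obtain x where "S = {x}" by (auto simp: card_1_singleton_iff)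
    then show ?thesis using R by (auto simp: min2_def)
  qed
  moreover have "S \<subseteq> {1..}" using R pos by (meson atLeast_iff le_trans subsetI)
  moreover have "p * card S \<le> Min S" using R mn by blast
  ultimately show "S \<in> Mpq p q n"
    using fin ne mx unfolding Mpq_def by blast
qed

section \<open>The three classes\<close>

lemma image_add_image_diff:
  fixes c :: nat
  assumes "\<forall>x\<in>U. c \<le> x"
  shows "(+) c ` ((\<lambda>x. x - c) ` U) = U"
proof -
  have "(\<lambda>x. c + (x - c)) ` U = (\<lambda>x. x) ` U" using assms by (intro image_cong) auto
  then show ?thesis by (simp add: image_image)
qed

text \<open>
  Exchanging \<open>m\<close> and \<open>m + 1\<close> as the maximum only matters for the bounds on the maximum itself.
  Lowering it is harmless when \<open>card S \<le> 2\<close> because \<open>2 * q \<le> m\<close>, and when \<open>card S > 2\<close> because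
  then some element other than the maximum already has to respect the bound with factor \<open>q\<close>.
\<close>

lemma card_Mpq_Suc_without_predecessor:
  assumes p: "p \<ge> 1" "p \<le> q" and m: "2 * q \<le> m"
  shows "card {S \<in> Mpq p q (Suc m). m \<notin> S} = card (Mpq p q m)"
proof (rule sym, rule bij_betw_same_card)
  let ?B = "{S \<in> Mpq p q (Suc m). m \<notin> S}"
  let ?f = "\<lambda>T. insert (Suc m) (T - {m})" and ?g = "\<lambda>S. insert m (S - {Suc m})"
  show "bij_betw ?f (Mpq p q m) ?B"
  proof (rule bij_betw_byWitness[where f' = ?g])
    show "\<forall>T\<in>Mpq p q m. ?g (?f T) = T"
    proof
      fix T assume "T \<in> Mpq p q m"
      then have "m \<in> T" "Suc m \<notin> T"
        unfolding mem_Mpq_iff[OF p(1)] by (blast, metis Suc_n_not_le_n)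
      then show "?g (?f T) = T" by blast
    qed
    show "\<forall>S\<in>?B. ?f (?g S) = S"
    proof
      fix S assume "S \<in> ?B"
      then have "m \<notin> S" "Suc m \<in> S" unfolding mem_Mpq_iff[OF p(1)] by blast+
      then show "?f (?g S) = S" by blast
    qed
    show "?f ` Mpq p q m \<subseteq> ?B"
    proof (rule image_subsetI)
      fix T assume "T \<in> Mpq p q m"
      note T = this[unfolded mem_Mpq_iff[OF p(1)]]
      have fin: "finite T" and mT: "m \<in> T" and qm: "q * card T \<le> m"
        and bounds: "\<And>x. x \<in> T \<Longrightarrow> p * card T \<le> x \<and> x \<le> m"
        and snd: "\<And>x y. x \<in> T \<Longrightarrow> y \<in> T \<Longrightarrow> y < x \<Longrightarrow> q * card T \<le> x"
        using T by blast+
      have "Suc m \<notin> T" using bounds by (metis Suc_n_not_le_n)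
      then have card: "card (?f T) = card T"
        using fin mT card_gt_0_iff[of T] by auto
      have "?f T \<in> Mpq p q (Suc m)"
        unfolding mem_Mpq_iff[OF p(1)] card
      proof (intro conjI ballI impI)
        show "q * card T \<le> Suc m" using qm by simp
        show "p * card T \<le> x" "x \<le> Suc m" if "x \<in> ?f T" for x
          using that bounds[of x] bounds[OF mT] by auto
        show "q * card T \<le> x" if "x \<in> ?f T" "y \<in> ?f T" "y < x" for x y
          using that snd[of x y] qm bounds[of x] by auto
      qed (use fin in auto)
      then show "?f T \<in> ?B" by simp
    qed
    show "?g ` ?B \<subseteq> Mpq p q m"
    proof (rule image_subsetI)
      fix S assume "S \<in> ?B"
      then have mS: "m \<notin> S" and "S \<in> Mpq p q (Suc m)" by auto
      note S = this(2)[unfolded mem_Mpq_iff[OF p(1)]]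
      have below: "x < m" if "x \<in> S - {Suc m}" for x
        using that S mS by (metis DiffE insertI1 le_SucE le_neq_implies_less)
      have card: "card (?g S) = card S"
        using S mS card_gt_0_iff[of S] by auto
      have q: "q * card S \<le> m"
      proof (cases "card S \<le> 2")
        case True
        then show ?thesis using m mult_le_mono2[OF True, of q] by linarith
      next
        case False
        then have "\<not> card (S - {Suc m}) \<le> Suc 0" using S by (simp add: card_Diff_singleton)
        then obtain x y where "x \<in> S - {Suc m}" "y \<in> S - {Suc m}" "y < x"
          using S by (metis card_le_Suc0_iff_eq finite_Diff linorder_neqE_nat)
        then show ?thesis using S below by (meson DiffD1 le_trans less_imp_le)
      qed
      moreover have "p * card S \<le> m" using q mult_le_mono1[OF p(2), of "card S"] by linarith
      ultimately show "?g S \<in> Mpq p q m"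
        unfolding mem_Mpq_iff[OF p(1)] card
      proof (intro conjI ballI impI)
        show "p * card S \<le> x" "x \<le> m" if "x \<in> ?g S" for x
          using that S below[of x] \<open>p * card S \<le> m\<close> by auto
        show "q * card S \<le> x" if "x \<in> ?g S" "y \<in> ?g S" "y < x" for x y
        proof (cases "x = m")
          case False
          then have "x \<in> S" "y \<in> S" using that below[of x] by auto
          then show ?thesis using S that(3) by blast
        qed (use q in simp)
      qed (use S in auto)
    qed
  qed
qed

text \<open>
  Shift a member of \<open>Mpq p q n\<close> up by \<open>q\<close> and add a new maximum.  The cardinality grows by one,
  so the bound for the second smallest element grows by \<open>q\<close>, exactly matching the shift, while
  the bound for the minimum grows by \<open>p\<close>, leaving the slack \<open>q - p\<close>.  The hypothesis \<open>q \<le> n\<close>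
  makes \<open>{n}\<close>, the preimage of \<open>{n + q, n + q + 1}\<close>, a member of \<open>Mpq p q n\<close>.
\<close>

lemma card_Mpq_Suc_large_Min:
  assumes p: "p \<ge> 1" "p \<le> q" and n: "q \<le> n"
  shows "card {S \<in> Mpq p q (Suc (n + q)). n + q \<in> S \<and> (\<forall>x\<in>S. p * card S + (q - p) \<le> x)}
    = card (Mpq p q n)"
proof (rule sym, rule bij_betw_same_card)
  let ?B = "{S \<in> Mpq p q (Suc (n + q)). n + q \<in> S \<and> (\<forall>x\<in>S. p * card S + (q - p) \<le> x)}"
  let ?f = "\<lambda>T. insert (Suc (n + q)) ((+) q ` T)"
  let ?g = "\<lambda>S. (\<lambda>x. x - q) ` (S - {Suc (n + q)})"
  \<comment> \<open>No element is truncated to \<open>0\<close> by the subtraction of \<open>q\<close>.\<close>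
  have big: "q \<le> x" if "S \<in> ?B" "x \<in> S" for S x
  proof -
    have "finite S" "S \<noteq> {}" using that unfolding mem_Mpq_iff[OF p(1)] by auto
    then have "p * 1 \<le> p * card S" by (intro mult_le_mono2) (simp add: Suc_le_eq card_gt_0_iff)
    moreover have "p * card S + (q - p) \<le> x" using that by blast
    ultimately show ?thesis by linarith
  qed
  show "bij_betw ?f (Mpq p q n) ?B"
  proof (rule bij_betw_byWitness[where f' = ?g])
    show "\<forall>T\<in>Mpq p q n. ?g (?f T) = T"
    proof
      fix T assume "T \<in> Mpq p q n"
      then have "Suc (n + q) \<notin> (+) q ` T" by (auto simp: mem_Mpq_iff[OF p(1)])
      then show "?g (?f T) = T" by (simp add: image_image)
    qed
    show fg: "\<forall>S\<in>?B. ?f (?g S) = S"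
    proof
      fix S assume S: "S \<in> ?B"
      then have "(+) q ` ?g S = S - {Suc (n + q)}"
        using big by (intro image_add_image_diff) blast
      moreover have "Suc (n + q) \<in> S" using S by (auto simp: mem_Mpq_iff[OF p(1)])
      ultimately show "?f (?g S) = S" by auto
    qed
    have card_f: "card (?f T) = Suc (card T)" if "finite T" "\<forall>x\<in>T. x \<le> n" for T
    proof -
      have "Suc (n + q) \<notin> (+) q ` T" using that by auto
      then show ?thesis using that by (simp add: card_image)
    qed
    show "?f ` Mpq p q n \<subseteq> ?B"
    proof (rule image_subsetI)
      fix T assume "T \<in> Mpq p q n"
      note T = this[unfolded mem_Mpq_iff[OF p(1)]]
      have "card (?f T) = Suc (card T)" using card_f T by blast
      then have qcard: "q * card (?f T) = q * card T + q" "p * card (?f T) = p * card T + p"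
        by simp_all
      have qn: "q * card T \<le> n" and nT: "n \<in> T"
        and bounds: "\<And>x. x \<in> T \<Longrightarrow> p * card T \<le> x \<and> x \<le> n"
        and snd: "\<And>x y. x \<in> T \<Longrightarrow> y \<in> T \<Longrightarrow> y < x \<Longrightarrow> q * card T \<le> x"
        using T by blast+
      have pn: "p * card T \<le> n" using bounds nT by blast
      have "?f T \<in> Mpq p q (Suc (n + q))"
        unfolding mem_Mpq_iff[OF p(1)] qcard
      proof (intro conjI ballI impI)
        show "q * card T + q \<le> Suc (n + q)" using qn by simp
        show "p * card T + p \<le> x" "x \<le> Suc (n + q)" if "x \<in> ?f T" for x
          using that bounds p(2) pn by fastforce+
        show "q * card T + q \<le> x" if xy: "x \<in> ?f T" "y \<in> ?f T" "y < x" for x y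
        proof (cases "x = Suc (n + q)")
          case False
          then obtain x' where x': "x = q + x'" "x' \<in> T" using xy(1) by blast
          then have "y \<noteq> Suc (n + q)" using xy(3) bounds[of x'] by auto
          then obtain y' where "y = q + y'" "y' \<in> T" using xy(2) by blast
          then show ?thesis using x' snd[of x' y'] xy(3) by simp
        qed (use qn in simp)
      qed (use T in auto)
      moreover have "p * card (?f T) + (q - p) \<le> x" if "x \<in> ?f T" for x
        unfolding qcard using that bounds p(2) pn by fastforce
      moreover have "n + q \<in> ?f T" using nT by (auto simp: add.commute)
      ultimately show "?f T \<in> ?B" by blast
    qed
    show "?g ` ?B \<subseteq> Mpq p q n"
    proof (rule image_subsetI)
      fix S assume SB: "S \<in> ?B"
      then have mS: "n + q \<in> S" and min: "\<forall>x\<in>S. p * card S + (q - p) \<le> x"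
        and "S \<in> Mpq p q (Suc (n + q))" by auto
      note S = this(3)[unfolded mem_Mpq_iff[OF p(1)]]
      define T where "T = ?g S"
      have ST: "S = ?f T" using fg SB unfolding T_def by (metis (no_types, lifting))
      have memS: "x + q \<in> S" if "x \<in> T" for x
        using that ST by (auto simp: add.commute)
      have le: "x \<le> n" if "x \<in> T" for x
        using that S unfolding T_def by fastforce
      have fin: "finite T" using S unfolding T_def by simp
      have card: "card S = Suc (card T)"
        using card_f[OF fin] le ST by simp
      have nT: "n \<in> T" using mS unfolding T_def by (force intro: image_eqI[of _ _ "n + q"])
      have small: "p * card T \<le> x" if "x \<in> T" for x
      proof -
        have "p * card S + (q - p) \<le> x + q" using min memS[OF that] by blast
        then show ?thesis using p card by simp
      qed
      have snd: "q * card T \<le> x" if "x \<in> T" "y \<in> T" "y < x" for x y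
      proof -
        have "q * card S \<le> x + q" using S memS that by (meson add_less_mono1)
        then show ?thesis using card by simp
      qed
      have "q * card T \<le> n"
      proof (cases "\<exists>y\<in>T. y < n")
        case True
        then show ?thesis using snd nT by blast
      next
        case False
        then have "T = {n}" using nT le by force
        then show ?thesis using n by simp
      qed
      then show "?g S \<in> Mpq p q n"
        using fin nT small le snd unfolding T_def[symmetric] mem_Mpq_iff[OF p(1)] by blast
    qed
  qed
qed

text \<open>
  Given \<open>j < q - p\<close> and \<open>R\<close> in \<open>Mq q n\<close>, let \<open>k = card R + 2\<close>.  The shift of \<open>R\<close> by \<open>2 * q\<close> has all its
  elements at least \<open>q * k\<close>, and \<open>p * k + j < q * k\<close>.  So inserting \<open>p * k + j\<close> creates a new
  minimum, and inserting \<open>n + 2 * q + 1\<close> a new maximum.  Conversely, a set in the class on the left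
  has exactly one element below \<open>q * card S\<close>; removing it and the maximum recovers \<open>j\<close> and \<open>R\<close>.
\<close>

lemma card_Mpq_Suc_small_Min:
  assumes p: "p \<ge> 1" "p < q"
  shows "card {S \<in> Mpq p q (Suc (n + 2 * q)). n + 2 * q \<in> S \<and> \<not> (\<forall>x\<in>S. p * card S + (q - p) \<le> x)}
    = (q - p) * card (Mq q n)"
proof -
  let ?m = "n + 2 * q"
  let ?B = "{S \<in> Mpq p q (Suc ?m). ?m \<in> S \<and> \<not> (\<forall>x\<in>S. p * card S + (q - p) \<le> x)}"
  let ?A = "{..<q - p} \<times> Mq q n"
  define h where "h = (\<lambda>(j, R). insert (p * (card R + 2) + j) (insert (Suc ?m) ((+) (2 * q) ` R)))"
  have q: "q \<ge> 1" using p by simp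
  have fR: "finite R" and nR: "n \<in> R" and R: "\<And>x. x \<in> R \<Longrightarrow> q * card R \<le> x \<and> x \<le> n"
    if "R \<in> Mq q n" for R
    using that by (auto simp: mem_Mq_iff[OF q])
  have gap: "p * k + j < q * k" if "j < q - p" "1 \<le> k" for j k
  proof -
    have "(q - p) * 1 \<le> (q - p) * k" using that by (intro mult_le_mono2)
    moreover have "p * k \<le> q * k" using p by simp
    ultimately show ?thesis using that by (simp add: diff_mult_distrib)
  qed
  have shifted: "q * (card R + 2) \<le> x \<and> x \<le> ?m" if "R \<in> Mq q n" "x \<in> (+) (2 * q) ` R" for R x
    using that R[OF that(1)] by (auto simp: algebra_simps)
  have least: "p * (card R + 2) + j < x"
    if "j < q - p" "R \<in> Mq q n" "x \<in> insert (Suc ?m) ((+) (2 * q) ` R)" for j R x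
  proof -
    have "?m \<in> (+) (2 * q) ` R" using nR[OF that(2)] by auto
    then have "q * (card R + 2) \<le> x" using shifted[OF that(2)] that(3) by (metis insertE le_SucI)
    then show ?thesis using gap[OF that(1), of "card R + 2"] by simp
  qed
  have card_h: "card (h (j, R)) = card R + 2" if "j < q - p" "R \<in> Mq q n" for j R
  proof -
    have "Suc ?m \<notin> (+) (2 * q) ` R" using shifted[OF that(2)] by (metis Suc_n_not_le_n)
    moreover have "p * (card R + 2) + j \<notin> insert (Suc ?m) ((+) (2 * q) ` R)"
      using least[OF that] by blast
    ultimately show ?thesis using fR[OF that(2)] by (simp add: h_def card_image)
  qed
  have "inj_on h ?A"
  proof (rule inj_onI)
    fix z z' assume z: "z \<in> ?A" "z' \<in> ?A" "h z = h z'"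
    obtain j R j' R' where zz: "z = (j, R)" "z' = (j', R')" by (metis surj_pair)
    have j: "j < q - p" and MR: "R \<in> Mq q n"
      and j': "j' < q - p" and MR': "R' \<in> Mq q n" and eq: "h (j, R) = h (j', R')"
      using z zz by auto
    let ?x = "p * (card R + 2) + j" and ?x' = "p * (card R' + 2) + j'"
    let ?U = "insert (Suc ?m) ((+) (2 * q) ` R)" and ?U' = "insert (Suc ?m) ((+) (2 * q) ` R')"
    have card: "card R = card R'" using card_h j j' MR MR' eq by (metis add_right_cancel)
    have ins: "insert ?x ?U = insert ?x' ?U'" using eq by (simp add: h_def)
    have lt: "\<And>u. u \<in> ?U \<Longrightarrow> ?x < u" and lt': "\<And>u. u \<in> ?U' \<Longrightarrow> ?x' < u"
      using least j j' MR MR' by blast+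
    \<comment> \<open>Both are the least element of the common value of \<open>h\<close>.\<close>
    have x: "?x = ?x'" using ins lt lt' by (metis insert_iff less_asym)
    then have "?U = ?U'" using ins lt lt' by (metis insert_ident less_irrefl)
    moreover have "Suc ?m \<notin> (+) (2 * q) ` R" "Suc ?m \<notin> (+) (2 * q) ` R'"
      using shifted MR MR' by (metis Suc_n_not_le_n)+
    ultimately have "(+) (2 * q) ` R = (+) (2 * q) ` R'" by (metis insert_ident)
    then have "R = R'" by (simp add: inj_image_eq_iff)
    then show "z = z'" using x zz by simp
  qed
  moreover have "h ` ?A = ?B"
  proof
    show "h ` ?A \<subseteq> ?B"
    proof (rule image_subsetI)
      fix z assume "z \<in> ?A"
      then obtain j R where z: "z = (j, R)" and j: "j < q - p" and MR: "R \<in> Mq q n" by blast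
      let ?x = "p * (card R + 2) + j" and ?U = "insert (Suc ?m) ((+) (2 * q) ` R)"
      have h: "h (j, R) = insert ?x ?U" by (simp add: h_def)
      have mU: "?m \<in> (+) (2 * q) ` R" using nR[OF MR] by auto
      have U: "q * (card R + 2) \<le> u \<and> u \<le> Suc ?m" if "u \<in> ?U" for u
        using that shifted[OF MR] mU by (metis insertE le_SucI order_refl)
      have xs: "?x < u" if "u \<in> ?U" for u using least[OF j MR that] .
      have fin: "finite (h (j, R))" using fR[OF MR] h by simp
      have mem: "?m \<in> h (j, R)" "Suc ?m \<in> h (j, R)" using mU h by auto
      have qm: "q * (card R + 2) \<le> Suc ?m" using U by blast
      have bounds: "p * (card R + 2) \<le> u \<and> u \<le> Suc ?m" if "u \<in> h (j, R)" for u
        using that U[of u] xs[of u] xs[of "Suc ?m"] unfolding h by force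
      have snd: "q * (card R + 2) \<le> u" if "u \<in> h (j, R)" "v \<in> h (j, R)" "v < u" for u v
        using that U[of u] xs[of v] unfolding h by fastforce
      have "S \<in> Mpq p q (Suc ?m)" if "S = h (j, R)" for S
        unfolding that mem_Mpq_iff[OF p(1)] card_h[OF j MR]
        using fin mem qm bounds snd by blast
      moreover have "\<not> (\<forall>x\<in>h (j, R). p * card (h (j, R)) + (q - p) \<le> x)"
        unfolding card_h[OF j MR] using j h by (auto intro!: bexI[of _ ?x])
      ultimately show "h z \<in> ?B" using mem z by blast
    qed
    show "?B \<subseteq> h ` ?A"
    proof
      fix S assume "S \<in> ?B"
      then have mS: "?m \<in> S" and "\<not> (\<forall>x\<in>S. p * card S + (q - p) \<le> x)"
        and "S \<in> Mpq p q (Suc ?m)" by auto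
      note S = this(3)[unfolded mem_Mpq_iff[OF p(1)]]
      obtain x where x: "x \<in> S" "x < p * card S + (q - p)"
        using \<open>\<not> (\<forall>x\<in>S. p * card S + (q - p) \<le> x)\<close> by (meson not_le)
      let ?k = "card S"
      have k: "1 \<le> ?k" using S by (metis One_nat_def Suc_leI card_gt_0_iff empty_iff)
      have xk: "x < q * ?k" using gap[of "x - p * ?k" ?k] x k S by auto
      have big: "q * ?k \<le> y" if "y \<in> S - {x}" for y
        using that S x xk by (metis DiffE insertI1 le_trans linorder_neqE_nat nat_less_le not_le)
      define U where "U = S - {x, Suc ?m}"
      define R where "R = (\<lambda>y. y - 2 * q) ` U"
      have "card {?m, Suc ?m} \<le> ?k" using mS S by (intro card_mono) auto
      then have k2: "2 \<le> ?k" by simp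
      then have "q * 2 \<le> q * ?k" by (intro mult_le_mono2)
      have xm: "x \<noteq> Suc ?m" using S xk by auto
      have card2: "?k = card U + 2"
        using k2 S xm x unfolding U_def by (subst card_Diff_subset) auto
      \<comment> \<open>\<open>R\<close> has to contain \<open>n\<close>, so the minimum must not be \<open>?m\<close>.  If it were, \<open>S\<close> would be
        \<open>{?m, Suc ?m}\<close>, and its minimum would be too large for the present class.\<close>
      have xm': "x \<noteq> ?m"
      proof
        assume "x = ?m"
        have "y = ?m \<or> y = Suc ?m" if "y \<in> S" for y
          using that S xk \<open>x = ?m\<close> big[of y] by (metis DiffI le_SucE le_antisym le_trans less_imp_le singletonD)
        then have "card S \<le> card {?m, Suc ?m}" by (intro card_mono) auto
        then have "q * ?k \<le> q * 2" by (intro mult_le_mono2) simp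
        then show False using xk \<open>x = ?m\<close> by linarith
      qed
      have "2 * q \<le> y" if "y \<in> U" for y
        using big[of y] \<open>q * 2 \<le> q * ?k\<close> that unfolding U_def by force
      then have UR: "(+) (2 * q) ` R = U"
        unfolding R_def by (intro image_add_image_diff) blast
      have cR: "card R = card U" using UR by (metis card_image inj_on_add)
      have "?m \<in> U" using mS xm' by (simp add: U_def)
      then have "n \<in> R" unfolding R_def by force
      moreover have "finite R" using S by (simp add: R_def U_def)
      moreover have "q * card R \<le> y \<and> y \<le> n" if "y \<in> R" for y
      proof -
        have "2 * q + y \<in> U" using that UR by blast
        then have "q * ?k \<le> 2 * q + y" "2 * q + y \<le> Suc ?m" "2 * q + y \<noteq> Suc ?m"
          using big S unfolding U_def by auto
        then show ?thesis using card2 cR by (simp add: algebra_simps)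
      qed
      ultimately have "R \<in> Mq q n" by (simp add: mem_Mq_iff[OF q])
      moreover have "x - p * ?k < q - p" using x S by auto
      moreover have "S = h (x - p * ?k, R)"
      proof -
        have "h (x - p * ?k, R) = insert x (insert (Suc ?m) U)"
          using S x(1) card2 cR UR by (auto simp: h_def)
        then show ?thesis using x S by (auto simp: U_def)
      qed
      ultimately show "S \<in> h ` ?A" by blast
    qed
  qed
  ultimately have "card ?A = card ?B" by (metis card_image)
  then show ?thesis by (simp add: card_cartesian_product)
qed

section \<open>The recurrence\<close>

lemma card_Mpq_recurrence:
  assumes p: "p \<ge> 1" "p < q"
  shows "card (Mpq p q (Suc (n + 2 * q)))
    = card (Mpq p q (n + 2 * q)) + card (Mpq p q (n + q)) + (q - p) * card (Mq q n)"
proof -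
  let ?m = "n + 2 * q" and ?P = "\<lambda>S. \<forall>x\<in>S. p * card S + (q - p) \<le> x"
  let ?M = "Mpq p q (Suc ?m)"
  have "card ?M = card ({S \<in> ?M. ?m \<notin> S} \<union> ({S \<in> ?M. ?m \<in> S \<and> ?P S} \<union> {S \<in> ?M. ?m \<in> S \<and> \<not> ?P S}))"
    by (rule arg_cong[where f = card]) blast
  also have "\<dots> = card {S \<in> ?M. ?m \<notin> S}
      + (card {S \<in> ?M. ?m \<in> S \<and> ?P S} + card {S \<in> ?M. ?m \<in> S \<and> \<not> ?P S})"
    by (subst card_Un_disjoint, auto simp: finite_Mpq)+
  also have "card {S \<in> ?M. ?m \<notin> S} = card (Mpq p q ?m)"
    using p by (intro card_Mpq_Suc_without_predecessor) auto
  also have "card {S \<in> ?M. ?m \<in> S \<and> ?P S} = card (Mpq p q (n + q))"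
    using card_Mpq_Suc_large_Min[of p q "n + q"] p by (simp add: mult_2 add.assoc)
  also have "card {S \<in> ?M. ?m \<in> S \<and> \<not> ?P S} = (q - p) * card (Mq q n)"
    by (rule card_Mpq_Suc_small_Min[OF p])
  finally show ?thesis by (simp add: add.assoc)
qed

theorem theorem1p3:
  fixes p q :: nat and a :: "nat \<Rightarrow> nat"
  assumes "p \<ge> 1" and "q \<ge> 1" and "p < q"
    and a_def: "\<And>n. n \<ge> 1 \<Longrightarrow> a n = card (Mpq p q (n + q))"
  shows "\<forall>n\<ge>1. a (n + q + 1) = a (n + q) + a n + (q - p) * card (Mq q n)"
proof (intro allI impI)
  fix n :: nat assume "n \<ge> 1"
  then show "a (n + q + 1) = a (n + q) + a n + (q - p) * card (Mq q n)"
    using card_Mpq_recurrence[OF assms(1,3), of n]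
    by (simp add: a_def mult_2 add.assoc)
qed

end
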